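(* Let $n\ge 1$ be an integer and let $(S_{i,j})_{1\le i\le n,\ j\ge 1}$ be any $n\times\infty$ matrix whose entries are sets with exactly $n$ elements. Then there exists an $n\times\infty$ matrix $(x_{i,j})_{1\le i\le n,\ j\ge 1}$ satisfying the following conditions: (1) for all $i$ and $j$, $x_{i,j}\in S_{i,j}$; (2) the first $n-2$ elements in each row are distinct and never repeated later in the row, i.e. for every $i$ and all $j<j'$ with $j\le n-2$ one has $x_{i,j}\neq x_{i,j'}$; (3) for every $t\ge 1$, the $n$ sets $\{x_{i,1},x_{i,2},\dots,x_{i,t}\}$, $i=1,\dots,n$ (one set for each row $i$), are pairwise distinct.
   Context: An $n\times\infty$ matrix is a family indexed by rows $i\in\{1,\dots,n\}$ and columns $j\in\{1,2,3,\dots\}$. When $n\le 2$, condition (2) is vacuous. *)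

theory Defs imports Main begin

end

theory Submission imports Defs begin

text \<open>
  The matrix is built online, column by column and inside a column row by row, with no knowledge of
  the sets still to come. Let \<open>A i\<close> be the set of entries chosen so far in row \<open>i\<close>. Distinctness of
  the sets \<open>A i\<close> alone can run into a dead end, so a further property is carried along: for all
  \<open>r \<ge> n\<close> and all finite \<open>L\<close> with at most \<open>r\<close> elements,
  \<open>card {i. L \<subseteq> A i \<and> card (A i) < r} + card L \<le> r\<close>. It says that the rows of size below \<open>r\<close> must not agree on too much. Its origin is the case in which all
  sets offered equal a fixed \<open>n\<close>-set \<open>W\<close>: after \<open>n - 1\<close> columns the rows have to omit distinct
  elements of \<open>W\<close>, and by Hall's theorem the property for \<open>r = n\<close> is the condition that such
  elements can be found outside the sets \<open>A i\<close>.

  Suppose row \<open>i\<close> may take a new element \<open>x\<close>. This destroys the property only if some \<open>L\<close> containing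
  \<open>x\<close>, with \<open>L - {x} \<subseteq> A i\<close>, already attains the bound. The number of rows containing \<open>L\<close> is
  supermodular in \<open>L\<close> while the bound \<open>r - card L\<close> is modular, and row \<open>i\<close> contains the intersection of
  two such \<open>L\<close> but neither of them; hence two different elements \<open>x\<close> and \<open>y\<close> cannot both be harmful
  (\<open>blocked_unique\<close>). An element can also be unusable because \<open>insert x (A i)\<close> is the set of another
  row. Such rows all contain \<open>A i\<close>, so the property with \<open>L = A i\<close> bounds their number, and the
  property for \<open>L - {x}\<close> excludes them for all elements other than a harmful \<open>x\<close>. As a result
  \<open>max 2 (n - card (A i))\<close> new elements always include a usable one (\<open>good_extension\<close>).

  Now let \<open>n \<ge> 2\<close>, and let \<open>F i\<close> consist of those entries already chosen in row \<open>i\<close> that lie in the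
  first \<open>n - 2\<close> columns, the ones that must not be repeated. The offered set minus \<open>F i\<close> has at
  least two elements. If it meets \<open>A i\<close>, an element of \<open>A i\<close> is repeated and nothing changes;
  otherwise it equals the offered set minus \<open>A i\<close> and is large enough for the previous paragraph.
\<close>

section \<open>Families of rows that do not agree too much\<close>

definition rows_above :: "('i \<Rightarrow> 'a set) \<Rightarrow> 'i set \<Rightarrow> nat \<Rightarrow> 'a set \<Rightarrow> 'i set" where
  "rows_above A I r L = {i \<in> I. L \<subseteq> A i \<and> card (A i) < r}"

definition spread :: "nat \<Rightarrow> 'i set \<Rightarrow> ('i \<Rightarrow> 'a set) \<Rightarrow> bool" where
  "spread n I A \<longleftrightarrow>
     (\<forall>r L. n \<le> r \<longrightarrow> finite L \<longrightarrow> card L \<le> r \<longrightarrow> card (rows_above A I r L) + card L \<le> r)"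

text \<open>
  The exception for the empty set lets the construction start with all rows empty.
\<close>

definition good :: "nat \<Rightarrow> 'i set \<Rightarrow> ('i \<Rightarrow> 'a set) \<Rightarrow> bool" where
  "good n I A \<longleftrightarrow> spread n I A \<and> (\<forall>i\<in>I. finite (A i)) \<and>
     (\<forall>i\<in>I. \<forall>k\<in>I. i \<noteq> k \<longrightarrow> A i = A k \<longrightarrow> A i = {})"

text \<open>
  Adding such a new element to row \<open>i\<close> would destroy \<open>spread\<close>: \<open>L\<close> attains the bound for \<open>r\<close>, and
  \<open>card (A i) + 2 \<le> r\<close> says that the enlarged row \<open>i\<close> is still small enough to be counted.
\<close>

definition blocked :: "nat \<Rightarrow> 'i set \<Rightarrow> ('i \<Rightarrow> 'a set) \<Rightarrow> 'i \<Rightarrow> 'a \<Rightarrow> bool" where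
  "blocked n I A i x \<longleftrightarrow>
     (\<exists>r L. n \<le> r \<and> x \<in> L \<and> L \<subseteq> insert x (A i) \<and> card (A i) + 2 \<le> r \<and>
            r \<le> card (rows_above A I r L) + card L)"

definition colliding :: "'i set \<Rightarrow> ('i \<Rightarrow> 'a set) \<Rightarrow> 'i \<Rightarrow> 'a \<Rightarrow> bool" where
  "colliding I A i x \<longleftrightarrow> (\<exists>k\<in>I - {i}. A k = insert x (A i))"

lemma spreadD:
  assumes "spread n I A" "n \<le> r" "finite L" "card L \<le> r"
  shows "card (rows_above A I r L) + card L \<le> r"
  using assms unfolding spread_def by blast

lemma finite_rows_above: "finite I \<Longrightarrow> finite (rows_above A I r L)"
  unfolding rows_above_def by simp

lemma good_empty:
  assumes "finite I" "card I \<le> n"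
  shows "good n I (\<lambda>i. {})"
proof -
  have "card (rows_above (\<lambda>i. {} :: 'b set) I r L) + card L \<le> r"
    if "n \<le> r" "finite L" "card L \<le> r" for r and L :: "'b set"
  proof (cases "L = {}")
    case True
    have "card (rows_above (\<lambda>i. {} :: 'b set) I r L) \<le> card I"
      by (rule card_mono) (use assms in \<open>auto simp: rows_above_def\<close>)
    then show ?thesis using True that assms by simp
  next
    case False
    then show ?thesis using that by (simp add: rows_above_def)
  qed
  then show ?thesis unfolding good_def spread_def by simp
qed

section \<open>Extending one row\<close>

text \<open>
  Only a set \<open>L\<close> that row \<open>i\<close> did not contain before gains a row, and it gains just row \<open>i\<close>; so the
  bound can only fail for an \<open>L\<close> that attained it.
\<close>

lemma spread_insert:
  assumes I: "finite I" "i \<in> I" and fin: "finite (A i)" and sp: "spread n I A"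
    and x: "x \<notin> A i" and nb: "\<not> blocked n I A i x"
  shows "spread n I (A(i := insert x (A i)))"
  unfolding spread_def
proof (intro allI impI)
  fix r and L :: "'b set" assume r: "n \<le> r" and L: "finite L" "card L \<le> r"
  let ?A = "A(i := insert x (A i))"
  let ?R = "rows_above A I r L" and ?R' = "rows_above ?A I r L"
  have old: "card ?R + card L \<le> r" using spreadD[OF sp r L] .
  have sub: "?R' \<subseteq> insert i ?R" by (auto simp: rows_above_def)
  show "card ?R' + card L \<le> r"
  proof (cases "?R' \<subseteq> ?R")
    case True
    then have "card ?R' \<le> card ?R" by (intro card_mono finite_rows_above I)
    then show ?thesis using old by simp
  next
    case False
    then have i: "i \<in> ?R'" "i \<notin> ?R" using sub by auto
    have Li: "L \<subseteq> insert x (A i)" and small: "card (A i) + 2 \<le> r"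
      using i(1) x fin by (auto simp: rows_above_def)
    have "x \<in> L" using i(2) I(2) Li small by (auto simp: rows_above_def)
    then have "card ?R + card L < r" using nb r Li small unfolding blocked_def by (meson not_less)
    moreover have "card ?R' \<le> Suc (card ?R)"
      using card_mono[OF _ sub] card_insert_le_m1 finite_rows_above[OF I(1)]
      by (metis (no_types, lifting) card_insert_disjoint finite_insert i(2))
    ultimately show ?thesis by simp
  qed
qed

text \<open>
  The number of rows containing a set is supermodular, strictly so here: row \<open>i\<close> contains the
  intersection of the two witnesses, but neither witness.
\<close>

lemma blocked_unique:
  assumes I: "finite I" "i \<in> I" and fin: "finite (A i)" and sp: "spread n I A"
    and x: "x \<notin> A i" "blocked n I A i x" and y: "y \<notin> A i" "blocked n I A i y"
  shows "x = y"
proof (rule ccontr)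
  assume "x \<noteq> y"
  have clash: False
    if xy: "x \<noteq> y" "x \<notin> A i" "y \<notin> A i" and rs: "n \<le> r" "r \<le> s" "card (A i) + 2 \<le> r"
      and K: "x \<in> K" "K \<subseteq> insert x (A i)" "r \<le> card (rows_above A I r K) + card K"
      and L: "y \<in> L" "L \<subseteq> insert y (A i)" "s \<le> card (rows_above A I s L) + card L"
    for x y r s K L
  proof -
    let ?X = "rows_above A I r K" and ?Y = "rows_above A I s L"
    have finX: "finite ?X" and finY: "finite ?Y" by (rule finite_rows_above[OF I(1)])+
    have fK: "finite K" and fL: "finite L" using K(2) L(2) fin finite_subset by blast+
    have int: "K \<inter> L \<subseteq> A i" using xy K L by blast
    have "K \<union> L \<subseteq> insert x (insert y (A i))" using K L by blast
    then have "card (K \<union> L) \<le> card (insert x (insert y (A i)))" using fin by (intro card_mono) auto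
    also have "\<dots> = card (A i) + 2" using xy fin by simp
    finally have cU: "card (K \<union> L) \<le> r" using rs by simp
    have "card (K \<inter> L) \<le> card (A i)" using int fin by (rule card_mono[rotated])
    then have cI: "card (K \<inter> L) \<le> s" using rs by simp
    have "insert i (?X \<union> ?Y) \<subseteq> rows_above A I s (K \<inter> L)"
      using int I(2) rs by (auto simp: rows_above_def)
    then have "card (insert i (?X \<union> ?Y)) \<le> card (rows_above A I s (K \<inter> L))"
      by (intro card_mono finite_rows_above I)
    moreover have "i \<notin> ?X \<union> ?Y" using xy K(1) L(1) by (auto simp: rows_above_def)
    ultimately have 1: "Suc (card (?X \<union> ?Y)) + card (K \<inter> L) \<le> s"
      using spreadD[OF sp _ _ cI] fK rs finX finY by simp
    have "?X \<inter> ?Y \<subseteq> rows_above A I r (K \<union> L)" by (auto simp: rows_above_def)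
    then have "card (?X \<inter> ?Y) \<le> card (rows_above A I r (K \<union> L))"
      by (intro card_mono finite_rows_above I)
    then have 2: "card (?X \<inter> ?Y) + card (K \<union> L) \<le> r"
      using spreadD[OF sp rs(1) _ cU] fK fL by simp
    have "card ?X + card ?Y = card (?X \<union> ?Y) + card (?X \<inter> ?Y)"
      using card_Un_Int[OF finX finY] .
    moreover have "card K + card L = card (K \<union> L) + card (K \<inter> L)"
      using card_Un_Int[OF fK fL] .
    ultimately show False using 1 2 K(3) L(3) by linarith
  qed
  obtain r K where 1: "n \<le> r" "x \<in> K" "K \<subseteq> insert x (A i)" "card (A i) + 2 \<le> r"
    "r \<le> card (rows_above A I r K) + card K" using x(2) unfolding blocked_def by blast
  obtain s L where 2: "n \<le> s" "y \<in> L" "L \<subseteq> insert y (A i)" "card (A i) + 2 \<le> s"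
    "s \<le> card (rows_above A I s L) + card L" using y(2) unfolding blocked_def by blast
  show False
  proof (cases "r \<le> s")
    case True
    from clash[OF \<open>x \<noteq> y\<close> x(1) y(1) 1(1) True 1(4,2,3,5) 2(2,3,5)] show False .
  next
    case False
    then have "s \<le> r" by simp
    from clash[OF \<open>x \<noteq> y\<close>[symmetric] y(1) x(1) 2(1) this 2(4,2,3,5) 1(2,3,5)] show False .
  qed
qed

text \<open>
  If \<open>L\<close> witnesses that \<open>x\<close> is blocked, then the bound for \<open>L - {x}\<close> leaves room for only one row
  besides those containing \<open>L\<close>. That room is taken by row \<open>i\<close>, and a row equal to
  \<open>insert y (A i)\<close> would be a second one.
\<close>

lemma blocked_imp_not_colliding:
  assumes I: "finite I" "i \<in> I" and fin: "finite (A i)" and sp: "spread n I A"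
    and x: "x \<notin> A i" "blocked n I A i x" and y: "y \<notin> A i" "y \<noteq> x"
  shows "\<not> colliding I A i y"
proof
  assume "colliding I A i y"
  then obtain k where k: "k \<in> I" "k \<noteq> i" "A k = insert y (A i)" unfolding colliding_def by blast
  obtain r L where r: "n \<le> r" "x \<in> L" "L \<subseteq> insert x (A i)" "card (A i) + 2 \<le> r"
    "r \<le> card (rows_above A I r L) + card L" using x(2) unfolding blocked_def by blast
  let ?X = "rows_above A I r L"
  have finX: "finite ?X" by (rule finite_rows_above[OF I(1)])
  have fL: "finite L" using r(3) fin finite_subset by blast
  have M: "L - {x} \<subseteq> A i" using r(3) by blast
  have cM: "card (L - {x}) \<le> r" using card_mono[OF fin M] r(4) by simp
  have "insert i (insert k ?X) \<subseteq> rows_above A I r (L - {x})"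
    using M I(2) k y r(4) fin by (auto simp: rows_above_def)
  then have "card (insert i (insert k ?X)) \<le> card (rows_above A I r (L - {x}))"
    by (intro card_mono finite_rows_above I)
  moreover have "i \<notin> ?X" "k \<notin> ?X" using k x y r(2) by (auto simp: rows_above_def)
  ultimately have "card ?X + 2 + card (L - {x}) \<le> r"
    using spreadD[OF sp r(1) _ cM] fL finX k(2) by simp
  moreover have "card L = Suc (card (L - {x}))" using card_Suc_Diff1[OF fL r(2)] by simp
  ultimately show False using r(5) by simp
qed

lemma exists_not_colliding:
  assumes I: "finite I" "i \<in> I" and fin: "finite (A i)" and sp: "spread n I A"
    and T: "finite T" "T \<inter> A i = {}" "2 \<le> card T" "n \<le> card T + card (A i)"
  shows "\<exists>x\<in>T. \<not> colliding I A i x"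
proof (rule ccontr)
  assume "\<not> ?thesis"
  then have "\<forall>x\<in>T. \<exists>k. k \<in> I - {i} \<and> A k = insert x (A i)" unfolding colliding_def by blast
  then obtain f where f: "\<And>x. x \<in> T \<Longrightarrow> f x \<in> I - {i} \<and> A (f x) = insert x (A i)" by metis
  have inj: "inj_on f T"
  proof (rule inj_onI)
    fix x y assume "x \<in> T" "y \<in> T" "f x = f y"
    then have "insert x (A i) = insert y (A i)" using f by metis
    then show "x = y" using T(2) \<open>x \<in> T\<close> by blast
  qed
  \<comment> \<open>The least bound that counts all rows \<open>insert x (A i)\<close>, each of size \<open>card (A i) + 1\<close>.\<close>
  let ?r = "max n (card (A i) + 2)"
  have "insert i (f ` T) \<subseteq> rows_above A I ?r (A i)"
    using f I(2) T(2) fin by (auto simp: rows_above_def card_insert_if)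
  then have "card (insert i (f ` T)) \<le> card (rows_above A I ?r (A i))"
    by (intro card_mono finite_rows_above I)
  moreover have "card (insert i (f ` T)) = Suc (card T)"
    using f T(1) card_image[OF inj] by (subst card_insert_disjoint) auto
  moreover have "card (rows_above A I ?r (A i)) + card (A i) \<le> ?r"
    by (rule spreadD[OF sp _ fin]) auto
  ultimately have "Suc (card T) + card (A i) \<le> ?r" by linarith
  then show False using T(3,4) by simp
qed

lemma good_extension:
  assumes I: "finite I" "i \<in> I" and good: "good n I A"
    and T: "finite T" "T \<inter> A i = {}" "2 \<le> card T" "n \<le> card T + card (A i)"
  shows "\<exists>x\<in>T. good n I (A(i := insert x (A i)))"
proof -
  have sp: "spread n I A" and fin: "finite (A i)" using good I(2) by (auto simp: good_def)
  have "\<exists>x\<in>T. \<not> blocked n I A i x \<and> \<not> colliding I A i x"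
  proof (cases "\<exists>x\<in>T. blocked n I A i x")
    case True
    then obtain x where x: "x \<in> T" "blocked n I A i x" by blast
    have "T \<noteq> {x}" using T(3) by auto
    then obtain y where y: "y \<in> T" "y \<noteq> x" using x(1) by blast
    have nA: "x \<notin> A i" "y \<notin> A i" using x(1) y(1) T(2) by auto
    have "\<not> blocked n I A i y" using blocked_unique[where A = A, OF I fin sp nA(1) x(2) nA(2)] y(2) by blast
    moreover have "\<not> colliding I A i y"
      using blocked_imp_not_colliding[where A = A, OF I fin sp nA(1) x(2) nA(2) y(2)] .
    ultimately show ?thesis using y(1) by blast
  next
    case False
    then show ?thesis using exists_not_colliding[where A = A, OF I fin sp T] by blast
  qed
  then obtain x where x: "x \<in> T" "\<not> blocked n I A i x" "\<not> colliding I A i x" by blast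
  have "spread n I (A(i := insert x (A i)))"
    using spread_insert[where A = A, OF I fin sp _ x(2)] x(1) T(2) by blast
  moreover have "A k \<noteq> insert x (A i)" if "k \<in> I" "k \<noteq> i" for k
    using x(3) that unfolding colliding_def by blast
  ultimately have "good n I (A(i := insert x (A i)))"
    using good unfolding good_def by (auto simp: fun_upd_apply dest: sym)
  then show ?thesis using x(1) by blast
qed

section \<open>Extending by a column and by infinitely many columns\<close>

lemma good_row_step:
  assumes I: "finite I" "i \<in> I" and good: "good n I A"
    and S: "finite S" "card S = n" and F: "F \<subseteq> A i" "card F + 2 \<le> n"
  shows "\<exists>x\<in>S - F. good n I (A(i := insert x (A i)))"
proof (cases "(S - F) \<inter> A i = {}")
  case True
  have fin: "finite (A i)" using good I(2) by (auto simp: good_def)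
  have 2: "2 \<le> card (S - F)" using diff_card_le_card_Diff[of F S] F fin finite_subset S(2) by fastforce
  have "S - F = S - A i" using True F(1) by blast
  then have "n \<le> card (S - F) + card (A i)"
    using diff_card_le_card_Diff[OF fin, of S] S(2) by simp
  from good_extension[OF I good _ True 2 this] S(1) show ?thesis by blast
next
  case False
  then obtain x where "x \<in> S - F" "insert x (A i) = A i" by blast
  then show ?thesis using good by (metis fun_upd_triv)
qed

lemma good_column_step:
  assumes I: "finite I" and good: "good n I A"
    and S: "\<And>i. i \<in> I \<Longrightarrow> finite (S i) \<and> card (S i) = n"
    and F: "\<And>i. i \<in> I \<Longrightarrow> F i \<subseteq> A i \<and> card (F i) + 2 \<le> n"
  shows "\<exists>c. (\<forall>i\<in>I. c i \<in> S i - F i) \<and> good n I (\<lambda>i. insert (c i) (A i))"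
proof -
  have part: "\<exists>c. (\<forall>i\<in>J. c i \<in> S i - F i) \<and> good n I (\<lambda>i. if i \<in> J then insert (c i) (A i) else A i)"
    if "finite J" "J \<subseteq> I" for J
    using that
  proof (induction J rule: finite_induct)
    case empty
    then show ?case using good by simp
  next
    case (insert k J)
    then obtain c where c: "\<forall>i\<in>J. c i \<in> S i - F i"
      and g: "good n I (\<lambda>i. if i \<in> J then insert (c i) (A i) else A i)" (is "good n I ?B") by blast
    have k: "k \<in> I" "k \<notin> J" using insert by auto
    obtain x where x: "x \<in> S k - F k" "good n I (?B(k := insert x (?B k)))"
      using good_row_step[where A = ?B and S = "S k" and F = "F k", OF I k(1) g] S F k by auto
    have "?B(k := insert x (?B k)) =
        (\<lambda>i. if i \<in> insert k J then insert ((c(k := x)) i) (A i) else A i)"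
      using k by (intro ext) auto
    moreover have "\<forall>i\<in>insert k J. (c(k := x)) i \<in> S i - F i" using c x(1) by auto
    ultimately show ?case using x(2) by metis
  qed
  obtain c where c: "\<forall>i\<in>I. c i \<in> S i - F i"
    and g: "good n I (\<lambda>i. if i \<in> I then insert (c i) (A i) else A i)" using part[OF I] by blast
  have "good n I (\<lambda>i. insert (c i) (A i))"
    using g unfolding good_def spread_def rows_above_def by (simp cong: conj_cong ball_cong)
  then show ?thesis using c by blast
qed

text \<open>
  Columns are numbered from \<open>0\<close>. When column \<open>t\<close> is about to be chosen, the images of \<open>{..<t}\<close> and
  of \<open>{..<min t (n - 2)}\<close> are the sets \<open>A i\<close> and \<open>F i\<close> of the introduction.
\<close>

lemma good_columns:
  assumes I: "finite I" "card I \<le> n" and n: "2 \<le> n"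
    and S: "\<And>i t. i \<in> I \<Longrightarrow> finite (S i t) \<and> card (S i t) = n"
  obtains c :: "nat \<Rightarrow> 'i \<Rightarrow> 'a" where
    "\<And>i t. i \<in> I \<Longrightarrow> c t i \<in> S i t - (\<lambda>j. c j i) ` {..<min t (n - 2)}"
    "\<And>t. good n I (\<lambda>i. (\<lambda>j. c j i) ` {..<t})"
proof -
  let ?A = "\<lambda>c t i. (\<lambda>j. c j i) ` {..<t}" and ?m = "\<lambda>t. min t (n - 2)"
  define P :: "(nat \<Rightarrow> 'i \<Rightarrow> 'a) \<Rightarrow> nat \<Rightarrow> ('i \<Rightarrow> 'a) \<Rightarrow> bool" where
    "P c t r \<longleftrightarrow> (\<forall>i\<in>I. r i \<in> S i t - ?A c (?m t) i) \<and> good n I (\<lambda>i. insert (r i) (?A c t i))"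
    for c t r
  have img: "?A c (Suc t) i = insert (c t i) (?A c t i)" for c :: "nat \<Rightarrow> 'i \<Rightarrow> 'a" and t i
    by (simp add: lessThan_Suc)
  have good_before: "good n I (?A c t)" if "\<forall>s<t. P c s (c s)" for c t
  proof (cases t)
    case 0
    then show ?thesis using good_empty[OF I] by simp
  next
    case (Suc u)
    then have "P c u (c u)" using that by simp
    then show ?thesis unfolding Suc img P_def by simp
  qed
  have "\<exists>c. \<forall>t. P c t (c t)"
  proof (rule dependent_wellorder_choice)
    fix r :: "'i \<Rightarrow> 'a" and c d :: "nat \<Rightarrow> 'i \<Rightarrow> 'a" and t
    assume eq: "\<And>s. s < t \<Longrightarrow> c s = d s"
    have "?A c u i = ?A d u i" if "u \<le> t" for u i
      using eq that by (intro image_cong) auto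
    then show "P c t r = P d t r" unfolding P_def by simp
  next
    fix t and c :: "nat \<Rightarrow> 'i \<Rightarrow> 'a"
    assume "\<And>s. s < t \<Longrightarrow> P c s (c s)"
    then have g: "good n I (?A c t)" using good_before by blast
    have F: "?A c (?m t) i \<subseteq> ?A c t i \<and> card (?A c (?m t) i) + 2 \<le> n" for i
    proof
      show "?A c (?m t) i \<subseteq> ?A c t i" by (rule image_mono) auto
      have "card (?A c (?m t) i) \<le> ?m t" using card_image_le[of "{..<?m t}"] by simp
      then show "card (?A c (?m t) i) + 2 \<le> n" using n by linarith
    qed
    show "\<exists>r. P c t r" unfolding P_def
      by (rule good_column_step[OF I(1) g]) (use S F in auto)
  qed
  then obtain c where c: "\<And>t. P c t (c t)" by blast
  show thesis
  proof (rule that)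
    show "c t i \<in> S i t - ?A c (?m t) i" if "i \<in> I" for i t
      using c[of t] that unfolding P_def by blast
    show "good n I (?A c t)" for t using good_before c by blast
  qed
qed

theorem theorem2:
  fixes n :: nat and S :: "nat \<Rightarrow> nat \<Rightarrow> 'a set"
  assumes "n \<ge> 1"
    and "\<And>i j. i \<in> {1..n} \<Longrightarrow> j \<ge> 1 \<Longrightarrow> finite (S i j) \<and> card (S i j) = n"
  shows "\<exists>x :: nat \<Rightarrow> nat \<Rightarrow> 'a.
      (\<forall>i\<in>{1..n}. \<forall>j\<ge>1. x i j \<in> S i j) \<and>
      (\<forall>i\<in>{1..n}. \<forall>j j'. 1 \<le> j \<and> j < j' \<and> j + 2 \<le> n \<longrightarrow> x i j \<noteq> x i j') \<and>
      (\<forall>t\<ge>1. \<forall>i\<in>{1..n}. \<forall>i'\<in>{1..n}. i \<noteq> i' \<longrightarrow> x i ` {1..t} \<noteq> x i' ` {1..t})"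
proof (cases "n = 1")
  case True
  \<comment> \<open>With a single row the last two conditions are vacuous.\<close>
  have "\<forall>i\<in>{1..n}. \<forall>j\<ge>1. (SOME a. a \<in> S i j) \<in> S i j"
    using assms by (metis card.empty not_one_le_zero some_in_eq)
  with True show ?thesis by (intro exI[of _ "\<lambda>i j. SOME a. a \<in> S i j"]) auto
next
  case False
  with assms(1) have n: "2 \<le> n" by simp
  obtain c where c: "\<And>i t. i \<in> {1..n} \<Longrightarrow>
        c t i \<in> S i (Suc t) - (\<lambda>j. c j i) ` {..<min t (n - 2)}"
    and good: "\<And>t. good n {1..n} (\<lambda>i. (\<lambda>j. c j i) ` {..<t})"
    using good_columns[of "{1..n}" n "\<lambda>i t. S i (Suc t)"] n assms(2) by auto
  let ?x = "\<lambda>i j. c (j - 1) i"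
  have img: "?x i ` {1..t} = (\<lambda>j. c j i) ` {..<t}" for i t
  proof -
    have "{1..t} = Suc ` {..<t}" by (simp add: image_Suc_lessThan)
    then show ?thesis by (simp add: image_image)
  qed
  show ?thesis
  proof (intro exI[of _ ?x] conjI ballI allI impI)
    fix i j :: nat assume "i \<in> {1..n}" "1 \<le> j"
    then show "?x i j \<in> S i j" using c[of i "j - 1"] by simp
  next
    fix i j j' :: nat assume i: "i \<in> {1..n}" and j: "1 \<le> j \<and> j < j' \<and> j + 2 \<le> n"
    then have "j - 1 < min (j' - 1) (n - 2)" by arith
    then have "?x i j \<in> (\<lambda>k. c k i) ` {..<min (j' - 1) (n - 2)}" by blast
    then show "?x i j \<noteq> ?x i j'" using c[OF i, of "j' - 1"] by (metis DiffD2)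
  next
    fix t i i' :: nat assume t: "1 \<le> t" and ii: "i \<in> {1..n}" "i' \<in> {1..n}" "i \<noteq> i'"
    have "(\<lambda>j. c j i) ` {..<t} \<noteq> {}" using t by (auto simp: lessThan_empty_iff)
    then show "?x i ` {1..t} \<noteq> ?x i' ` {1..t}"
      using good[of t] ii unfolding img good_def by blast
  qed
qed

end
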